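(* Consider a left-invariant Lorentzian problem on $G=\mathrm{Aff}_+(\mathbb R)$ given by a matrix $A=\begin{pmatrix}a&b\\c&d\end{pmatrix}$, $|A|>0$, $a\ge0$, with sectional curvature $K=0$. Let $\Pi=\{(\tilde x,\tilde y)\in\mathbb R^2_1:\ s_1\tilde y+\tilde x<1/\gamma\}$. The mapping $i:\mathrm{Aff}_+(\mathbb R)\to\Pi\subset\mathbb R^2_1$, $$i(x,y)=(\tilde x,\tilde y)=\left(\frac12\left(\frac{y-1}{y}-\frac{w}{\gamma}\right),\ \frac{s_1}{2}\left(\frac{y-1}{y}+\frac{w}{\gamma}\right)\right),\qquad w=\frac{x+\mathsf g(y-1)}{f},$$ is an isometry, that is, $\tilde d(i(q_1),i(q_2))=d(q_1,q_2)$ for all $q_1,q_2\in\mathrm{Aff}_+(\mathbb R)$, where $d$ and $\tilde d$ are the Lorentzian distances on $\mathrm{Aff}_+(\mathbb R)$ and on the Minkowski plane $\mathbb R^2_1$.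
   Context: $G=\mathrm{Aff}_+(\mathbb R)=\{(x,y)\in\mathbb R^2: y>0\}$ with product $(x_2,y_2)\cdot(x_1,y_1)=(x_2+y_2x_1,\,y_2y_1)$; left-invariant frame $X_1=y\,\partial_x$, $X_2=y\,\partial_y$. A real matrix $A=\begin{pmatrix}a&b\\c&d\end{pmatrix}$ with $|A|=ad-bc>0$ determines the left-invariant Lorentzian form $g(u_1X_1+u_2X_2)=-v_1^2+v_2^2$, $v_1=au_1+bu_2$, $v_2=cu_1+du_2$, with time orientation in which future directed nonspacelike vectors are those with $v_1\ge|v_2|$. Standing assumption of the paper: $a\ge0$. Write $A^{-1}=\begin{pmatrix}\alpha&\beta\\ \gamma&\delta\end{pmatrix}$. The sectional curvature is $K=(c^2-a^2)/|A|^2=\gamma^2-\delta^2$. For $K=0$: $s_1=\operatorname{sgn}\gamma$, $f=-\frac{\alpha-s_1\beta}{2\gamma}$, $\mathsf g=-\frac{\alpha+s_1\beta}{2\gamma}$. On a time-oriented Lorentzian manifold, the Lorentzian distance from $p$ to $q$ is the supremum of the lengths $\int|g(\dot q)|^{1/2}dt$ of Lipschitz future directed nonspacelike curves from $p$ to $q$, and $0$ if there are none. $\mathbb R^2_1$ is $\mathbb R^2$ with coordinates $(\tilde x,\tilde y)$, metric $-d\tilde x^2+d\tilde y^2$, future directed nonspacelike vectors being those with $\dot{\tilde x}\ge|\dot{\tilde y}|$; thus $\tilde d(\tilde q_1,\tilde q_2)=\sqrt{(\tilde x_2-\tilde x_1)^2-(\tilde y_2-\tilde y_1)^2}$ if $\tilde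 x_2-\tilde x_1>|\tilde y_2-\tilde y_1|$ and $0$ otherwise.
   Formalization: The printed map multiplies the metric by γ, so the claim fails unless γ=1; proved with (y-1)/y replaced by (y-1)/(γy) in both components of i and with Π={γ(s₁ỹ+x̃)<1}, i.e. s₁ỹ+x̃<1/γ for γ>0 and s₁ỹ+x̃>1/γ for γ<0. *)

theory Defs
  imports "HOL-Analysis.Analysis"
begin

section \<open>Lorentzian distance on domains of a Euclidean space\<close>

text \<open>
  The manifolds considered are open subsets of a Euclidean space, so tangent vectors are elements of
  that space. A time-oriented Lorentzian structure is given by the domain \<open>M\<close>, the quadratic forms
  \<open>g p\<close>, and the sets \<open>C p\<close> of future directed nonspacelike vectors at \<open>p\<close>. On a compact
  interval, being Lipschitz does not depend on the Riemannian metric used, so the Euclidean one is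
  taken.
\<close>

definition future_curve ::
  "'a::euclidean_space set \<Rightarrow> ('a \<Rightarrow> 'a set) \<Rightarrow> (real \<Rightarrow> 'a) \<Rightarrow> real \<Rightarrow> real \<Rightarrow> bool" where
  "future_curve M C q t0 t1 \<longleftrightarrow>
     t0 < t1 \<and> q ` {t0..t1} \<subseteq> M \<and> (\<exists>L. L-lipschitz_on {t0..t1} q) \<and>
     (AE t in lborel. t \<in> {t0<..<t1} \<longrightarrow>
        (\<exists>v. (q has_vector_derivative v) (at t) \<and> v \<in> C (q t)))"

definition curve_length ::
  "('a::euclidean_space \<Rightarrow> 'a \<Rightarrow> real) \<Rightarrow> (real \<Rightarrow> 'a) \<Rightarrow> real \<Rightarrow> real \<Rightarrow> ennreal" where
  "curve_length g q t0 t1 =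
     (\<integral>\<^sup>+ t\<in>{t0..t1}. ennreal (sqrt \<bar>g (q t) (vector_derivative q (at t))\<bar>) \<partial>lborel)"

text \<open>In \<^typ>\<open>ennreal\<close> the supremum of the empty set is \<open>0\<close>, and an unbounded set of lengths has
  supremum \<open>\<infinity>\<close>.\<close>

definition lorentz_dist ::
  "'a::euclidean_space set \<Rightarrow> ('a \<Rightarrow> 'a \<Rightarrow> real) \<Rightarrow> ('a \<Rightarrow> 'a set) \<Rightarrow> 'a \<Rightarrow> 'a \<Rightarrow> ennreal" where
  "lorentz_dist M g C p p' =
     Sup {curve_length g q t0 t1 | q t0 t1. future_curve M C q t0 t1 \<and> q t0 = p \<and> q t1 = p'}"


section \<open>The Minkowski plane\<close>

definition mink_form :: "real \<times> real \<Rightarrow> real \<times> real \<Rightarrow> real" where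
  "mink_form p \<xi> = - (fst \<xi>)\<^sup>2 + (snd \<xi>)\<^sup>2"

definition mink_cone :: "real \<times> real \<Rightarrow> (real \<times> real) set" where
  "mink_cone p = {\<xi>. fst \<xi> \<ge> \<bar>snd \<xi>\<bar>}"

definition mink_dist :: "real \<times> real \<Rightarrow> real \<times> real \<Rightarrow> ennreal" where
  "mink_dist = lorentz_dist UNIV mink_form mink_cone"


section \<open>The group and its left-invariant Lorentzian structures\<close>

definition Aff :: "(real \<times> real) set" where
  "Aff = {(x, y). y > 0}"

definition aff_mult :: "real \<times> real \<Rightarrow> real \<times> real \<Rightarrow> real \<times> real" where
  "aff_mult p q = (fst p + snd p * fst q, snd p * snd q)"

definition X1 :: "real \<times> real \<Rightarrow> real \<times> real" where
  "X1 q = (snd q, 0)"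

definition X2 :: "real \<times> real \<Rightarrow> real \<times> real" where
  "X2 q = (0, snd q)"

text \<open>The coefficients \<open>(u\<^sub>1, u\<^sub>2)\<close> of a tangent vector \<open>\<xi>\<close> at \<open>q\<close> in the frame \<open>X1, X2\<close>.\<close>

definition frame_coord :: "real \<times> real \<Rightarrow> real \<times> real \<Rightarrow> real^2" where
  "frame_coord q \<xi> = vector [fst \<xi> / snd q, snd \<xi> / snd q]"

lemma frame_coord:
  assumes "q \<in> Aff"
  shows "frame_coord q \<xi> $ 1 *\<^sub>R X1 q + frame_coord q \<xi> $ 2 *\<^sub>R X2 q = \<xi>"
  using assms by (auto simp: Aff_def frame_coord_def X1_def X2_def prod_eq_iff)

lemma frame_left_invariant:
  assumes "(aff_mult p has_derivative D) (at q)"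
  shows "D (X1 q) = X1 (aff_mult p q)" "D (X2 q) = X2 (aff_mult p q)"
proof -
  have "(aff_mult p has_derivative (\<lambda>\<xi>. (snd p * fst \<xi>, snd p * snd \<xi>))) (at q)"
    unfolding aff_mult_def [abs_def] by (auto intro!: derivative_eq_intros)
  then have "D = (\<lambda>\<xi>. (snd p * fst \<xi>, snd p * snd \<xi>))"
    using assms has_derivative_unique by blast
  then show "D (X1 q) = X1 (aff_mult p q)" "D (X2 q) = X2 (aff_mult p q)"
    by (auto simp: X1_def X2_def aff_mult_def)
qed

definition aff_form :: "real^2^2 \<Rightarrow> real \<times> real \<Rightarrow> real \<times> real \<Rightarrow> real" where
  "aff_form A q \<xi> = (let v = A *v frame_coord q \<xi> in - (v$1)\<^sup>2 + (v$2)\<^sup>2)"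

definition aff_cone :: "real^2^2 \<Rightarrow> real \<times> real \<Rightarrow> (real \<times> real) set" where
  "aff_cone A q = {\<xi>. let v = A *v frame_coord q \<xi> in v$1 \<ge> \<bar>v$2\<bar>}"

definition aff_dist :: "real^2^2 \<Rightarrow> real \<times> real \<Rightarrow> real \<times> real \<Rightarrow> ennreal" where
  "aff_dist A = lorentz_dist Aff (aff_form A) (aff_cone A)"


section \<open>Sectional curvature\<close>

text \<open>
  A left-invariant vector field is represented by its constant coefficients in the frame \<open>X1, X2\<close>,
  for which \<open>[X1, X2] = - X1\<close>. The Levi-Civita connection is determined by the Koszul formula, whose
  derivative terms vanish on left-invariant fields.
\<close>

definition lie_bracket :: "real^2 \<Rightarrow> real^2 \<Rightarrow> real^2" where
  "lie_bracket u w = vector [- (u$1 * w$2 - u$2 * w$1), 0]"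

definition lform :: "real^2^2 \<Rightarrow> real^2 \<Rightarrow> real^2 \<Rightarrow> real" where
  "lform A u w = - ((A *v u)$1 * (A *v w)$1) + (A *v u)$2 * (A *v w)$2"

definition levi_civita :: "real^2^2 \<Rightarrow> real^2 \<Rightarrow> real^2 \<Rightarrow> real^2" where
  "levi_civita A u w = (THE n. \<forall>z. 2 * lform A n z =
     lform A (lie_bracket u w) z - lform A (lie_bracket w z) u + lform A (lie_bracket z u) w)"

definition riemann :: "real^2^2 \<Rightarrow> real^2 \<Rightarrow> real^2 \<Rightarrow> real^2 \<Rightarrow> real^2" where
  "riemann A u w z = levi_civita A u (levi_civita A w z) - levi_civita A w (levi_civita A u z)
     - levi_civita A (lie_bracket u w) z"

definition sectional_curvature :: "real^2^2 \<Rightarrow> real" where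
  "sectional_curvature A = (let e1 = axis 1 1; e2 = axis 2 1 in
     lform A (riemann A e1 e2 e2) e1 / (lform A e1 e1 * lform A e2 e2 - (lform A e1 e2)\<^sup>2))"

lemma mv2:
  fixes A :: "real^2^2"
  shows "(A *v u)$1 = A$1$1 * u$1 + A$1$2 * u$2" "(A *v u)$2 = A$2$1 * u$1 + A$2$2 * u$2"
  by (simp_all add: matrix_vector_mult_def sum_2)

lemma levi_civita_eq:
  assumes "det A \<noteq> 0"
  defines "E \<equiv> (A$2$1)\<^sup>2 - (A$1$1)\<^sup>2"
    and "F \<equiv> A$2$1 * A$2$2 - A$1$1 * A$1$2"
    and "H \<equiv> (A$2$2)\<^sup>2 - (A$1$2)\<^sup>2"
  shows "levi_civita A u w =
    (let k = u$1 * w$2 - u$2 * w$1; a = E * u$1 + F * u$2; b = E * w$1 + F * w$2;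
         l1 = - k * E - w$2 * a - u$2 * b; l2 = - k * F + w$1 * a + u$1 * b
     in vector [(F * l2 - H * l1) / (2 * (det A)\<^sup>2), (F * l1 - E * l2) / (2 * (det A)\<^sup>2)])"
proof -
  define k where "k = u$1 * w$2 - u$2 * w$1"
  define a where "a = E * u$1 + F * u$2"
  define b where "b = E * w$1 + F * w$2"
  define l1 where "l1 = - k * E - w$2 * a - u$2 * b"
  define l2 where "l2 = - k * F + w$1 * a + u$1 * b"
  define N :: "real^2" where
    "N = vector [(F * l2 - H * l1) / (2 * (det A)\<^sup>2), (F * l1 - E * l2) / (2 * (det A)\<^sup>2)]"
  have D: "E * H - F\<^sup>2 = - (det A)\<^sup>2"
    unfolding E_def F_def H_def det_2 by algebra
  have ip: "lform A n z = (E * n$1 + F * n$2) * z$1 + (F * n$1 + H * n$2) * z$2" for n z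
    unfolding lform_def mv2 E_def F_def H_def by algebra
  have rhs: "lform A (lie_bracket u w) z - lform A (lie_bracket w z) u + lform A (lie_bracket z u) w
      = l1 * z$1 + l2 * z$2" for z
    unfolding ip lie_bracket_def l1_def l2_def k_def a_def b_def vector_2 by algebra
  have eq: "(\<forall>z. 2 * lform A n z = l1 * z$1 + l2 * z$2) \<longleftrightarrow>
      2 * (E * n$1 + F * n$2) = l1 \<and> 2 * (F * n$1 + H * n$2) = l2" for n
  proof
    assume *: "\<forall>z. 2 * lform A n z = l1 * z$1 + l2 * z$2"
    from *[rule_format, of "vector [1, 0]"] *[rule_format, of "vector [0, 1]"]
    show "2 * (E * n$1 + F * n$2) = l1 \<and> 2 * (F * n$1 + H * n$2) = l2" by (simp add: ip)
  next
    assume *: "2 * (E * n$1 + F * n$2) = l1 \<and> 2 * (F * n$1 + H * n$2) = l2"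
    then have l: "l1 = 2 * (E * n$1 + F * n$2)" "l2 = 2 * (F * n$1 + H * n$2)" by auto
    show "\<forall>z. 2 * lform A n z = l1 * z$1 + l2 * z$2"
      unfolding ip l by (simp add: algebra_simps)
  qed
  have sol: "2 * (E * n$1 + F * n$2) = l1 \<and> 2 * (F * n$1 + H * n$2) = l2 \<longleftrightarrow> n = N" for n :: "real^2"
  proof -
    have d: "(det A)\<^sup>2 \<noteq> 0" using assms(1) by simp
    have "n = N \<longleftrightarrow> 2 * (det A)\<^sup>2 * n$1 = F * l2 - H * l1 \<and> 2 * (det A)\<^sup>2 * n$2 = F * l1 - E * l2"
      unfolding N_def vec_eq_iff forall_2 vector_2 using d by (simp add: field_simps)
    also have "\<dots> \<longleftrightarrow> 2 * (E * n$1 + F * n$2) = l1 \<and> 2 * (F * n$1 + H * n$2) = l2"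
    proof
      assume *: "2 * (det A)\<^sup>2 * n$1 = F * l2 - H * l1 \<and> 2 * (det A)\<^sup>2 * n$2 = F * l1 - E * l2"
      have "(det A)\<^sup>2 * (2 * (E * n$1 + F * n$2)) = (det A)\<^sup>2 * l1"
        "(det A)\<^sup>2 * (2 * (F * n$1 + H * n$2)) = (det A)\<^sup>2 * l2"
        using * D by algebra+
      then show "2 * (E * n$1 + F * n$2) = l1 \<and> 2 * (F * n$1 + H * n$2) = l2" using d by simp
    next
      assume "2 * (E * n$1 + F * n$2) = l1 \<and> 2 * (F * n$1 + H * n$2) = l2"
      then have l: "l1 = 2 * (E * n$1 + F * n$2)" "l2 = 2 * (F * n$1 + H * n$2)" by auto
      have d': "(det A)\<^sup>2 = F\<^sup>2 - E * H" using D by simp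
      show "2 * (det A)\<^sup>2 * n$1 = F * l2 - H * l1 \<and> 2 * (det A)\<^sup>2 * n$2 = F * l1 - E * l2"
        unfolding l d' by (simp add: algebra_simps power2_eq_square)
    qed
    finally show ?thesis by simp
  qed
  have "levi_civita A u w = N"
    unfolding levi_civita_def rhs eq sol by simp
  then show ?thesis
    unfolding N_def l1_def l2_def k_def a_def b_def Let_def .
qed

lemma sectional_curvature_eq:
  assumes "det A \<noteq> 0"
  shows "sectional_curvature A = ((A$2$1)\<^sup>2 - (A$1$1)\<^sup>2) / (det A)\<^sup>2"
proof -
  define E where "E = (A$2$1)\<^sup>2 - (A$1$1)\<^sup>2"
  define F where "F = A$2$1 * A$2$2 - A$1$1 * A$1$2"
  define H where "H = (A$2$2)\<^sup>2 - (A$1$2)\<^sup>2"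
  define D where "D = (det A)\<^sup>2"
  define e1 e2 :: "real^2" where "e1 = axis 1 1" and "e2 = axis 2 1"
  have e: "e1$1 = 1" "e1$2 = 0" "e2$1 = 0" "e2$2 = 1"
    by (simp_all add: e1_def e2_def axis_def)
  have D: "E * H - F\<^sup>2 = - D"
    unfolding E_def F_def H_def D_def det_2 by algebra
  have D0: "D \<noteq> 0"
    using assms by (simp add: D_def)
  have ip: "lform A n z = (E * n$1 + F * n$2) * z$1 + (F * n$1 + H * n$2) * z$2" for n z
    unfolding lform_def mv2 E_def F_def H_def by algebra
  note lc = levi_civita_eq [OF assms, folded E_def F_def H_def D_def, unfolded Let_def]
  have lc1: "levi_civita A e1 n = vector [E * (F * n$1 + H * n$2) / D, - E * (E * n$1 + F * n$2) / D]" for n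
    unfolding lc e vec_eq_iff forall_2 vector_2 using D0 by (simp add: field_simps)
  have lc2: "levi_civita A e2 n = vector [F * (F * n$1 + H * n$2) / D, - F * (E * n$1 + F * n$2) / D]" for n
    unfolding lc e vec_eq_iff forall_2 vector_2 using D0 by (simp add: field_simps)
  have br: "lie_bracket e1 e2 = - e1"
    unfolding lie_bracket_def e vec_eq_iff forall_2 by (simp add: e)
  have lcm: "levi_civita A (- e1) n = - levi_civita A e1 n" for n
    unfolding lc1 unfolding lc vec_eq_iff forall_2
    using D0 by (simp add: e field_simps)
  have R: "riemann A e1 e2 e2 = levi_civita A e1 e2"
    unfolding riemann_def br lcm unfolding lc1 lc2 vec_eq_iff forall_2
    using D0 by (simp add: e field_simps)
  have "lform A (riemann A e1 e2 e2) e1 = E * (E * H - F\<^sup>2) / D"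
    unfolding R ip lc1 using D0 by (simp add: e field_simps power2_eq_square)
  also have "\<dots> = - E"
    unfolding D using D0 by simp
  finally have "lform A (riemann A e1 e2 e2) e1 = - E" .
  moreover have "lform A e1 e1 * lform A e2 e2 - (lform A e1 e2)\<^sup>2 = - D"
    unfolding ip D[symmetric] by (simp add: e power2_eq_square)
  ultimately show ?thesis
    unfolding sectional_curvature_def Let_def e1_def[symmetric] e2_def[symmetric]
    by (simp flip: E_def D_def)
qed


section \<open>The map to the Minkowski plane in the flat case\<close>

definition gamma_coeff :: "real^2^2 \<Rightarrow> real" where
  "gamma_coeff A = matrix_inv A $ 2 $ 1"

definition s1 :: "real^2^2 \<Rightarrow> real" where
  "s1 A = sgn (gamma_coeff A)"

definition f_coeff :: "real^2^2 \<Rightarrow> real" where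
  "f_coeff A = - (matrix_inv A $ 1 $ 1 - s1 A * matrix_inv A $ 1 $ 2) / (2 * gamma_coeff A)"

definition g_coeff :: "real^2^2 \<Rightarrow> real" where
  "g_coeff A = - (matrix_inv A $ 1 $ 1 + s1 A * matrix_inv A $ 1 $ 2) / (2 * gamma_coeff A)"

text \<open>
  Write \<open>(x', y')\<close> for the image of \<open>(x, y)\<close>. In terms of the linear forms \<open>v = A u\<close> at \<open>(x, y)\<close>,
  \<open>d(x' + s\<^sub>1 y') = (v\<^sub>1 + s\<^sub>1 v\<^sub>2) / y\<close> and \<open>d(x' - s\<^sub>1 y') = y (v\<^sub>1 - s\<^sub>1 v\<^sub>2)\<close>.
  The first identity forces the null coordinate \<open>x' + s\<^sub>1 y'\<close> to be \<open>(y - 1) / (\<gamma> y)\<close>: with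
  \<open>(y - 1) / y\<close> in its place, the map would multiply the metric by \<open>\<gamma>\<close>, and for \<open>\<gamma> < 0\<close> it would not
  preserve future cones. The image is bounded by the null line \<open>s\<^sub>1 y' + x' = 1 / \<gamma>\<close>, and it is the
  side \<open>s\<^sub>1 y' + x' < 1 / \<gamma>\<close> when \<open>\<gamma> > 0\<close>, the side \<open>s\<^sub>1 y' + x' > 1 / \<gamma>\<close> when \<open>\<gamma> < 0\<close>.
\<close>

definition flat_map :: "real^2^2 \<Rightarrow> real \<times> real \<Rightarrow> real \<times> real" where
  "flat_map A q =
    (let x = fst q; y = snd q; \<gamma> = gamma_coeff A; w = (x + g_coeff A * (y - 1)) / f_coeff A
     in (1/2 * ((y - 1) / (\<gamma> * y) - w / \<gamma>), s1 A / 2 * ((y - 1) / (\<gamma> * y) + w / \<gamma>)))"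

definition half_plane :: "real^2^2 \<Rightarrow> (real \<times> real) set" where
  "half_plane A = {(x, y). gamma_coeff A * (s1 A * y + x) < 1}"

lemma half_plane_eq:
  "gamma_coeff A > 0 \<Longrightarrow> half_plane A = {(x, y). s1 A * y + x < 1 / gamma_coeff A}"
  "gamma_coeff A < 0 \<Longrightarrow> half_plane A = {(x, y). s1 A * y + x > 1 / gamma_coeff A}"
  by (auto simp: half_plane_def field_simps)

end

theory Submission
  imports Defs
begin

text \<open>
  The quadratic form of a Lorentzian plane is minus the product of two linear forms, and a vector is
  future directed nonspacelike when both factors are nonnegative. For the left-invariant structure
  the factors are \<open>v\<^sub>1 + s\<^sub>1 v\<^sub>2\<close> and \<open>v\<^sub>1 - s\<^sub>1 v\<^sub>2\<close>; when \<open>K = 0\<close>, one has \<open>c = - s\<^sub>1 a\<close> and the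
  first factor at \<open>(x, y)\<close> is \<open>dy / (\<gamma> y)\<close>. Divided by \<open>y\<close> it is exact, and the second factor is exact
  once multiplied by \<open>y\<close>. These opposite rescalings do not change the product or the signs, so the two
  primitives \<open>(1 - 1/y) / \<gamma>\<close> and \<open>2 a (x + g (y - 1))\<close> are null coordinates of a flat Minkowski plane:
  they are \<open>x' + s\<^sub>1 y'\<close> and \<open>x' - s\<^sub>1 y'\<close> for the image \<open>(x', y')\<close> under \<open>flat_map\<close>. Hence the
  differential of \<open>flat_map\<close> carries form and cone of the group to those of the Minkowski plane
  (\<open>aff_null\<close>, \<open>dflat_map_null\<close>), and the same holds for the explicit inverse on the half-plane.

  A map with this infinitesimal property carries future curves to future curves of the same length
  (\<open>lorentz_dist_le_isometric_map\<close>), which bounds the distance in its domain by the distance in its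
  target. Applied to \<open>flat_map\<close>, with the whole Minkowski plane as target, this gives one inequality.

  The inverse gives the other inequality only for curves that stay in the half-plane, whereas the
  Minkowski distance is taken over all curves in the plane. The two suprema agree because the
  boundary of the half-plane is a level line of the null coordinate \<open>x' + s\<^sub>1 y'\<close>, which is monotone
  along future curves: a curve with both ends in the half-plane never leaves it
  (\<open>half_plane_causally_convex\<close>). As curves are only Lipschitz, this monotonicity rests on the fact
  that a Lipschitz function with derivative \<open>\<ge> 0\<close> almost everywhere is nondecreasing
  (\<open>Lipschitz_AE_deriv_nonneg_imp_le\<close>).
\<close>

section \<open>Lipschitz functions\<close>

text \<open>
  If \<open>h a > h b\<close>, then \<open>h\<close> takes every value between them, and at the last time it takes such
  a value it cannot have a positive derivative. So the last time is exceptional for every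
  value in \<open>{h b<..<h a}\<close>; but a Lipschitz function maps the null set of exceptional times to a null
  set, which cannot cover an interval.
\<close>

lemma Lipschitz_AE_deriv_pos_imp_le:
  fixes h :: "real \<Rightarrow> real"
  assumes "a \<le> b"
    and lip: "L-lipschitz_on {a..b} h"
    and pos: "AE t in lborel. t \<in> {a<..<b} \<longrightarrow> (\<exists>D>0. (h has_real_derivative D) (at t))"
  shows "h a \<le> h b"
proof (rule ccontr)
  assume "\<not> h a \<le> h b"
  then have less: "h b < h a" by simp
  obtain N where N: "\<And>t. t \<notin> N \<Longrightarrow> t \<in> {a<..<b} \<Longrightarrow> \<exists>D>0. (h has_real_derivative D) (at t)"
    and null: "N \<in> null_sets lborel"
    by (rule AE_E3[OF pos]) auto
  have "negligible N"
    using null by (simp add: negligible_iff_null_sets null_sets_completionI)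
  then have negl: "negligible (N \<inter> {a..b})" by (rule negligible_subset) simp
  have "negligible (h ` (N \<inter> {a..b}))"
  proof (rule negligible_locally_Lipschitz_image[OF _ negl])
    fix x assume x: "x \<in> N \<inter> {a..b}"
    have "\<forall>y\<in>N \<inter> {a..b}. norm (h y - h x) \<le> L * norm (y - x)"
      using x lipschitz_on_normD[OF lip] by auto
    then show "\<exists>T B. open T \<and> x \<in> T \<and> (\<forall>y\<in>N \<inter> {a..b} \<inter> T. norm (h y - h x) \<le> B * norm (y - x))"
      by (intro exI[of _ UNIV] exI[of _ L]) auto
  qed simp
  then have "\<not> {h b<..<h a} \<subseteq> h ` (N \<inter> {a..b})"
    using less negligible_subset[of "h ` (N \<inter> {a..b})" "{h b<..<h a}"]
      open_not_negligible[of "{h b<..<h a}"] by auto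
  then obtain c where "c \<in> {h b<..<h a}" and "c \<notin> h ` (N \<inter> {a..b})" by blast
  then have c: "h b < c" "c < h a" "c \<notin> h ` (N \<inter> {a..b})" by auto
  have cont: "continuous_on {a..b} h" by (rule lipschitz_on_continuous_on[OF lip])
  (* the maximum of S is the last time at which h takes the value c *)
  define S where "S = {a..b} \<inter> h -` {c..}"
  have "closed S"
    unfolding S_def by (rule continuous_closed_preimage[OF cont]) auto
  then have "compact S"
    by (auto simp: S_def compact_eq_bounded_closed intro: bounded_subset[of "{a..b}"])
  moreover have "a \<in> S" using c \<open>a \<le> b\<close> by (simp add: S_def)
  ultimately obtain t where t: "t \<in> S" and last: "\<And>u. u \<in> S \<Longrightarrow> u \<le> t"
    using compact_attains_sup[of S] by blast
  have tab: "a \<le> t" "t < b" "h t \<ge> c"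
    using t c by (auto simp: S_def less_le)
  have "h t = c"
  proof (rule ccontr)
    assume "h t \<noteq> c"
    then have "c \<le> h t" using tab by simp
    then obtain u where u: "t \<le> u" "u \<le> b" "h u = c"
      using IVT2'[of h b c t] c tab continuous_on_subset[OF cont, of "{t..b}"] by auto
    then have "u \<in> S" using tab by (simp add: S_def)
    then show False using last[of u] u \<open>h t \<noteq> c\<close> by auto
  qed
  then have "t \<notin> N" "t \<noteq> a" using c tab by auto
  then obtain D where "D > 0" "(h has_real_derivative D) (at t)"
    using N[of t] tab by (auto simp: less_le)
  then obtain d where d: "d > 0" "\<And>e. e > 0 \<Longrightarrow> e < d \<Longrightarrow> h t < h (t + e)"
    using DERIV_pos_inc_right by blast
  define e where "e = min (d / 2) (b - t)"
  have e: "0 < e" "e < d" "t + e \<le> b" using d tab by (auto simp: e_def)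
  then have "t + e \<in> S" using d(2)[of e] \<open>h t = c\<close> tab by (auto simp: S_def)
  then show False using last e by force
qed

text \<open>
  Adding \<open>k * t\<close> with small \<open>k > 0\<close> makes the derivative positive.
\<close>

lemma Lipschitz_AE_deriv_nonneg_imp_le:
  fixes h :: "real \<Rightarrow> real"
  assumes "a \<le> b"
    and lip: "L-lipschitz_on {a..b} h"
    and nonneg: "AE t in lborel. t \<in> {a<..<b} \<longrightarrow> (\<exists>D\<ge>0. (h has_real_derivative D) (at t))"
  shows "h a \<le> h b"
proof (rule field_le_epsilon)
  fix e :: real assume "e > 0"
  (* the summand 1 keeps the denominator positive when a = b *)
  define k where "k = e / (b - a + 1)"
  have k: "k > 0" "k * (b - a) \<le> e"
    using \<open>e > 0\<close> \<open>a \<le> b\<close> by (auto simp: k_def field_simps)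
  have "h a + k * a \<le> h b + k * b"
  proof (rule Lipschitz_AE_deriv_pos_imp_le[OF \<open>a \<le> b\<close>])
    show "(L + \<bar>k\<bar> * 1)-lipschitz_on {a..b} (\<lambda>t. h t + k * t)"
      by (intro lipschitz_intros lip)
    show "AE t in lborel. t \<in> {a<..<b} \<longrightarrow> (\<exists>D>0. ((\<lambda>t. h t + k * t) has_real_derivative D) (at t))"
      using nonneg
    proof eventually_elim
      case (elim t)
      show ?case
      proof
        assume "t \<in> {a<..<b}"
        with elim obtain D where D: "D \<ge> 0" "(h has_real_derivative D) (at t)" by auto
        have "((\<lambda>t. h t + k * t) has_real_derivative D + k) (at t)"
          using D by (auto intro!: derivative_eq_intros)
        then show "\<exists>D>0. ((\<lambda>t. h t + k * t) has_real_derivative D) (at t)"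
          using D k by (intro exI[of _ "D + k"]) auto
      qed
    qed
  qed
  then show "h a \<le> h b + e" using k by (simp add: algebra_simps)
qed

lemma Lipschitz_on_fst: "1-lipschitz_on K fst"
  by (rule lipschitz_onI) (auto intro: dist_fst_le)

lemma Lipschitz_on_snd: "1-lipschitz_on K snd"
  by (rule lipschitz_onI) (auto intro: dist_snd_le)

text \<open>On a compact set \<open>h\<close> is bounded below by a positive constant, its minimum.\<close>

lemma Lipschitz_on_inverse_if_pos:
  fixes h :: "'a::metric_space \<Rightarrow> real"
  assumes "compact K" and lip: "L-lipschitz_on K h" and pos: "\<And>x. x \<in> K \<Longrightarrow> h x > 0"
  shows "\<exists>L. L-lipschitz_on K (\<lambda>x. 1 / h x)"
proof (cases "K = {}")
  case False
  then obtain x0 where x0: "x0 \<in> K" "\<And>x. x \<in> K \<Longrightarrow> h x0 \<le> h x"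
    using continuous_attains_inf[OF \<open>compact K\<close> _ lipschitz_on_continuous_on[OF lip]] by blast
  define m where "m = h x0"
  have m: "m > 0" "\<And>x. x \<in> K \<Longrightarrow> m \<le> h x" using x0 pos by (auto simp: m_def)
  have "(L / m\<^sup>2)-lipschitz_on K (\<lambda>x. 1 / h x)"
  proof (rule lipschitz_onI)
    fix x y assume xy: "x \<in> K" "y \<in> K"
    have h: "h x > 0" "h y > 0" using xy pos by auto
    have "1 / h x - 1 / h y = (h y - h x) / (h x * h y)"
      using h by (simp add: field_simps)
    then have "dist (1 / h x) (1 / h y) = dist (h x) (h y) / (h x * h y)"
      using h by (simp add: dist_real_def abs_mult abs_minus_commute)
    also have "\<dots> \<le> (L * dist x y) / m\<^sup>2"
      unfolding power2_eq_square
      using xy m lipschitz_onD[OF lip xy] lipschitz_on_nonneg[OF lip]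
      by (intro frac_le mult_mono) (auto intro: less_imp_le[OF h(1)])
    finally show "dist (1 / h x) (1 / h y) \<le> L / m\<^sup>2 * dist x y" by simp
  qed (use m lipschitz_on_nonneg[OF lip] in auto)
  then show ?thesis ..
qed auto

section \<open>Maps of Lorentzian structures\<close>

text \<open>
  Composition with \<open>F\<close> turns a future curve of \<open>M\<close> into a future curve of \<open>N\<close> with the same length, so
  the supremum for \<open>N\<close> is taken over at least the same lengths. The form has to be preserved on the
  cone only, because velocities lie there almost everywhere. A curve has compact image, which is why
  a Lipschitz bound for \<open>F\<close> on compact sets is enough.
\<close>

lemma lorentz_dist_le_isometric_map:
  fixes F :: "'a::euclidean_space \<Rightarrow> 'b::euclidean_space"
  assumes maps: "\<And>q. q \<in> M \<Longrightarrow> F q \<in> N"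
    and lips: "\<And>K. compact K \<Longrightarrow> K \<subseteq> M \<Longrightarrow> \<exists>L. L-lipschitz_on K F"
    and deriv: "\<And>q. q \<in> M \<Longrightarrow> (F has_derivative DF q) (at q)"
    and cone: "\<And>q v. q \<in> M \<Longrightarrow> v \<in> C q \<Longrightarrow> DF q v \<in> C' (F q)"
    and form: "\<And>q v. q \<in> M \<Longrightarrow> v \<in> C q \<Longrightarrow> g' (F q) (DF q v) = g q v"
  shows "lorentz_dist M g C p p' \<le> lorentz_dist N g' C' (F p) (F p')"
  unfolding lorentz_dist_def
proof (rule Sup_mono, safe)
  fix q t0 t1 assume q: "future_curve M C q t0 t1"
  from q have t01: "t0 < t1" and qM: "q ` {t0..t1} \<subseteq> M"
    and "\<exists>L. L-lipschitz_on {t0..t1} q"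
    and der: "AE t in lborel. t \<in> {t0<..<t1} \<longrightarrow>
        (\<exists>v. (q has_vector_derivative v) (at t) \<and> v \<in> C (q t))"
    by (auto simp: future_curve_def)
  then obtain L where L: "L-lipschitz_on {t0..t1} q" by blast
  have "compact (q ` {t0..t1})"
    by (intro compact_continuous_image lipschitz_on_continuous_on[OF L]) auto
  then obtain L' where "L'-lipschitz_on (q ` {t0..t1}) F" using lips qM by blast
  then have lip: "(L' * L)-lipschitz_on {t0..t1} (F \<circ> q)"
    using lipschitz_on_compose[OF L] by blast
  have chain: "(F \<circ> q has_vector_derivative DF (q t) v) (at t)"
    if "t \<in> {t0<..<t1}" "(q has_vector_derivative v) (at t)" for t v
  proof -
    have "q t \<in> M" using that qM by force
    then show ?thesis
      using vector_derivative_diff_chain_within[OF that(2)] deriv has_derivative_at_withinI by blast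
  qed
  have "future_curve N C' (F \<circ> q) t0 t1"
    unfolding future_curve_def
  proof (intro conjI)
    show "AE t in lborel. t \<in> {t0<..<t1} \<longrightarrow>
        (\<exists>v. (F \<circ> q has_vector_derivative v) (at t) \<and> v \<in> C' ((F \<circ> q) t))"
      using der
    proof eventually_elim
      case (elim t)
      show ?case
      proof
        assume t: "t \<in> {t0<..<t1}"
        with elim obtain v where v: "(q has_vector_derivative v) (at t)" "v \<in> C (q t)" by blast
        have "q t \<in> M" using t qM by force
        then show "\<exists>v. (F \<circ> q has_vector_derivative v) (at t) \<and> v \<in> C' ((F \<circ> q) t)"
          using chain[OF t v(1)] cone[OF _ v(2)] by auto
      qed
    qed
  qed (use t01 qM maps lip in auto)
  moreover have "curve_length g' (F \<circ> q) t0 t1 = curve_length g q t0 t1"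
    unfolding curve_length_def
  proof (rule nn_integral_cong_AE)
    show "AE t in lborel.
        ennreal (sqrt \<bar>g' ((F \<circ> q) t) (vector_derivative (F \<circ> q) (at t))\<bar>) * indicator {t0..t1} t =
        ennreal (sqrt \<bar>g (q t) (vector_derivative q (at t))\<bar>) * indicator {t0..t1} t"
      using der AE_lborel_singleton[of t0] AE_lborel_singleton[of t1]
    proof eventually_elim
      case (elim t)
      show ?case
      proof (cases "t \<in> {t0..t1}")
        case True
        then have t: "t \<in> {t0<..<t1}" using elim by auto
        with elim obtain v where v: "(q has_vector_derivative v) (at t)" "v \<in> C (q t)" by blast
        have "q t \<in> M" using t qM by force
        then show ?thesis
          using vector_derivative_at[OF chain[OF t v(1)]] vector_derivative_at[OF v(1)] form[OF _ v(2)]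
          by simp
      qed simp
    qed
  qed
  ultimately show "\<exists>l\<in>{curve_length g' c u0 u1 | c u0 u1.
        future_curve N C' c u0 u1 \<and> c u0 = F (q t0) \<and> c u1 = F (q t1)}.
      curve_length g q t0 t1 \<le> l"
    by (intro bexI[of _ "curve_length g' (F \<circ> q) t0 t1"] CollectI exI[of _ "F \<circ> q"]
        exI[of _ t0] exI[of _ t1]) auto
qed

lemma lorentz_dist_causally_convex:
  assumes "M \<subseteq> N"
    and "\<And>q t0 t1. future_curve N C q t0 t1 \<Longrightarrow> q t0 = p \<Longrightarrow> q t1 = p' \<Longrightarrow> q ` {t0..t1} \<subseteq> M"
  shows "lorentz_dist M g C p p' = lorentz_dist N g C p p'"
proof -
  have "future_curve M C q t0 t1 \<and> q t0 = p \<and> q t1 = p' \<longleftrightarrow>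
      future_curve N C q t0 t1 \<and> q t0 = p \<and> q t1 = p'" for q t0 t1
    using assms(1) assms(2)[of q t0 t1] by (fastforce simp: future_curve_def)
  then show ?thesis by (simp add: lorentz_dist_def)
qed

section \<open>Null coordinates on the Minkowski plane\<close>

text \<open>
  Both signs \<open>s = 1\<close> and \<open>s = -1\<close> occur below: the sign decides which of the two families of null
  lines contains the boundary of the half-plane.
\<close>

lemma mink_form_null:
  assumes "\<bar>s\<bar> = 1"
  shows "mink_form z \<xi> = - ((fst \<xi> + s * snd \<xi>) * (fst \<xi> - s * snd \<xi>))"
proof -
  have "s = 1 \<or> s = -1" using assms by (auto simp: abs_if split: if_splits)
  then show ?thesis by (auto simp: mink_form_def power2_eq_square algebra_simps)
qed

lemma mink_cone_null:
  assumes "\<bar>s\<bar> = 1"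
  shows "\<xi> \<in> mink_cone z \<longleftrightarrow> 0 \<le> fst \<xi> + s * snd \<xi> \<and> 0 \<le> fst \<xi> - s * snd \<xi>"
proof -
  have "s = 1 \<or> s = -1" using assms by (auto simp: abs_if split: if_splits)
  then show ?thesis by (auto simp: mink_cone_def)
qed

text \<open>
  The derivative of a null coordinate along a future curve is one of the two factors that are
  nonnegative on the cone.
\<close>

lemma null_coordinate_mono:
  assumes s: "\<bar>s\<bar> = 1" and q: "future_curve UNIV mink_cone q t0 t1"
    and t: "t0 \<le> t" "t \<le> t'" "t' \<le> t1"
  shows "fst (q t) + s * snd (q t) \<le> fst (q t') + s * snd (q t')"
proof -
  define l :: "real \<times> real \<Rightarrow> real" where "l = (\<lambda>z. fst z + s * snd z)"
  have l: "bounded_linear l"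
    unfolding l_def by (intro bounded_linear_intros)
  from q obtain L where L: "L-lipschitz_on {t0..t1} q"
    and der: "AE t in lborel. t \<in> {t0<..<t1} \<longrightarrow>
        (\<exists>v. (q has_vector_derivative v) (at t) \<and> v \<in> mink_cone (q t))"
    by (auto simp: future_curve_def)
  obtain B where B: "B-lipschitz_on (q ` {t..t'}) l"
    using bounded_linear.lipschitz_boundE[OF l] by metis
  have "l (q t) \<le> l (q t')"
  proof (rule Lipschitz_AE_deriv_nonneg_imp_le[OF t(2)])
    show "(B * L)-lipschitz_on {t..t'} (\<lambda>t. l (q t))"
      using t B lipschitz_on_subset[OF L, of "{t..t'}"] by (intro lipschitz_on_compose2) auto
    show "AE u in lborel. u \<in> {t<..<t'} \<longrightarrow> (\<exists>D\<ge>0. ((\<lambda>t. l (q t)) has_real_derivative D) (at u))"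
      using der
    proof eventually_elim
      case (elim u)
      show ?case
      proof
        assume "u \<in> {t<..<t'}"
        then have "u \<in> {t0<..<t1}" using t by auto
        with elim obtain v where v: "(q has_vector_derivative v) (at u)" "v \<in> mink_cone (q u)"
          by blast
        have "((\<lambda>t. l (q t)) has_real_derivative l v) (at u)"
          using bounded_linear.has_vector_derivative[OF l v(1)]
          by (simp add: has_real_derivative_iff_has_vector_derivative)
        moreover have "l v \<ge> 0" using v(2) by (simp add: l_def mink_cone_null[OF s])
        ultimately show "\<exists>D\<ge>0. ((\<lambda>t. l (q t)) has_real_derivative D) (at u)" by blast
      qed
    qed
  qed
  then show ?thesis by (simp add: l_def)
qed

section \<open>Flat left-invariant structures\<close>

lemma matrix_inv_2:
  fixes A :: "real^2^2"
  assumes "det A \<noteq> 0"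
  shows "det A * matrix_inv A $ 1 $ 1 = A $ 2 $ 2" "det A * matrix_inv A $ 1 $ 2 = - A $ 1 $ 2"
    "det A * matrix_inv A $ 2 $ 1 = - A $ 2 $ 1" "det A * matrix_inv A $ 2 $ 2 = A $ 1 $ 1"
proof -
  have cramer: "(a * d - b * c) * p = d * k - b * l \<and> (a * d - b * c) * r = a * l - c * k"
    if "a * p + b * r = k" "c * p + d * r = l" for a b c d p r k l :: real
    unfolding that [symmetric] by (simp add: algebra_simps)
  have "invertible A" using assms by (simp add: invertible_det_nz)
  then have "A ** matrix_inv A = mat 1"
    unfolding matrix_inv_def invertible_def by (rule someI2_ex) auto
  then have *: "A$1$1 * matrix_inv A$1$1 + A$1$2 * matrix_inv A$2$1 = 1"
    "A$2$1 * matrix_inv A$1$1 + A$2$2 * matrix_inv A$2$1 = 0"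
    "A$1$1 * matrix_inv A$1$2 + A$1$2 * matrix_inv A$2$2 = 0"
    "A$2$1 * matrix_inv A$1$2 + A$2$2 * matrix_inv A$2$2 = 1"
    by (auto simp: matrix_matrix_mult_def vec_eq_iff forall_2 sum_2 mat_def)
  show "det A * matrix_inv A $ 1 $ 1 = A $ 2 $ 2" "det A * matrix_inv A $ 1 $ 2 = - A $ 1 $ 2"
    "det A * matrix_inv A $ 2 $ 1 = - A $ 2 $ 1" "det A * matrix_inv A $ 2 $ 2 = A $ 1 $ 1"
    unfolding det_2 using cramer[OF *(1,2)] cramer[OF *(3,4)] by simp_all
qed

locale flat_structure =
  fixes A :: "real^2^2"
  assumes det_pos: "det A > 0" and A11: "A $ 1 $ 1 \<ge> 0" and flat: "sectional_curvature A = 0"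
begin

abbreviation "a \<equiv> A $ 1 $ 1"
abbreviation "s \<equiv> s1 A"
abbreviation "\<gamma> \<equiv> gamma_coeff A"
abbreviation "m \<equiv> g_coeff A"

text \<open>
  Flatness means \<open>c\<^sup>2 = a\<^sup>2\<close>. As \<open>A\<close> is invertible and \<open>a \<ge> 0\<close>, this forces \<open>a > 0\<close> and \<open>c = - s a\<close>, and
  then \<open>det A = a (d + s b)\<close>. The equations for \<open>b + s d\<close> and \<open>b - s d\<close> give the coefficients of \<open>u\<^sub>2\<close>
  in the two null forms.
\<close>

lemma coeffs:
  shows a_pos: "a > 0" and s_abs: "\<bar>s\<bar> = 1" and \<gamma>_nz: "\<gamma> \<noteq> 0"
    and A21: "A $ 2 $ 1 = - s * a"
    and A12_A22: "\<gamma> * (A $ 1 $ 2 + s * A $ 2 $ 2) = 1"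
    and f_\<gamma>: "f_coeff A * \<gamma> = - 1 / (2 * a)"
    and m_eq: "2 * a * m = A $ 1 $ 2 - s * A $ 2 $ 2"
proof -
  have det: "det A \<noteq> 0" using det_pos by simp
  have sq: "(A$2$1)\<^sup>2 = a\<^sup>2"
    using flat sectional_curvature_eq[OF det] det by simp
  show a: "a > 0"
    using sq A11 det by (cases "a = 0") (auto simp: det_2)
  have c: "A$2$1 = a \<or> A$2$1 = - a" using sq by (simp add: power2_eq_iff)
  have \<gamma>: "\<gamma> = - A$2$1 / det A"
    using matrix_inv_2(3)[OF det] det by (simp add: gamma_coeff_def field_simps)
  have s: "s = - sgn (A$2$1)"
    using det_pos by (simp add: s1_def \<gamma> sgn_divide)
  then show A21: "A$2$1 = - s * a" using c a by auto
  show s_abs: "\<bar>s\<bar> = 1" using s c a by auto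
  show nz: "\<gamma> \<noteq> 0" using \<gamma> c a det by auto
  have ss: "s * s = 1" "s * (s * x) = x" for x
    using s_abs by (metis abs_mult_self_eq mult_1, metis abs_mult_self_eq mult_1 mult.assoc)
  define k where "k = A$2$2 + s * A$1$2"
  have k: "A$1$2 + s * A$2$2 = s * k" "A$2$2 - s * A$1$2 = - s * (A$1$2 - s * A$2$2)"
    by (simp_all add: k_def distrib_left right_diff_distrib ss)
  have D: "det A = a * k"
    by (simp add: det_2 A21 k_def algebra_simps)
  have "k \<noteq> 0" using D det by auto
  have \<gamma>': "\<gamma> = s / k" unfolding \<gamma> D A21 using a by simp
  show "\<gamma> * (A$1$2 + s * A$2$2) = 1"
    unfolding k(1) \<gamma>' using ss \<open>k \<noteq> 0\<close> by simp
  have \<alpha>: "matrix_inv A$1$1 = A$2$2 / (a * k)" "matrix_inv A$1$2 = - A$1$2 / (a * k)"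
    using matrix_inv_2(1,2)[OF det] det unfolding D by (simp_all add: field_simps)
  have "f_coeff A * \<gamma> = - (matrix_inv A$1$1 - s * matrix_inv A$1$2) / 2"
    using nz by (simp add: f_coeff_def)
  also have "matrix_inv A$1$1 - s * matrix_inv A$1$2 = k / (a * k)"
    unfolding \<alpha> by (simp add: k_def add_divide_distrib)
  finally show "f_coeff A * \<gamma> = - 1 / (2 * a)"
    using \<open>k \<noteq> 0\<close> by simp
  have "m * \<gamma> = - (matrix_inv A$1$1 + s * matrix_inv A$1$2) / 2"
    using nz by (simp add: g_coeff_def)
  also have "matrix_inv A$1$1 + s * matrix_inv A$1$2 = (A$2$2 - s * A$1$2) / (a * k)"
    unfolding \<alpha> by (simp add: diff_divide_distrib)
  finally have "m * s = s * (A$1$2 - s * A$2$2) / (2 * a)"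
    unfolding \<gamma>' k(2) using \<open>k \<noteq> 0\<close> a by (simp add: field_simps)
  then have "s * (2 * a * m) = s * (A$1$2 - s * A$2$2)"
    using a by (simp add: field_simps)
  moreover have "s \<noteq> 0" using s_abs by auto
  ultimately show "2 * a * m = A$1$2 - s * A$2$2" by (metis mult_left_cancel)
qed

lemma ss [simp]: "s * s = 1" "s * (s * x) = x"
  using s_abs by (metis abs_mult_self_eq mult_1, metis abs_mult_self_eq mult_1 mult.assoc)

text \<open>
  The null coordinates \<open>x' + s y'\<close> and \<open>x' - s y'\<close> of the image, expressed by the point of the group,
  and their differentials.
\<close>

definition null1 :: "real \<times> real \<Rightarrow> real" where
  "null1 q = (1 - 1 / snd q) / \<gamma>"

definition null2 :: "real \<times> real \<Rightarrow> real" where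
  "null2 q = 2 * a * (fst q + m * (snd q - 1))"

definition dnull1 :: "real \<times> real \<Rightarrow> real \<times> real \<Rightarrow> real" where
  "dnull1 q \<xi> = snd \<xi> / (\<gamma> * (snd q)\<^sup>2)"

definition dnull2 :: "real \<times> real \<Rightarrow> real" where
  "dnull2 \<xi> = 2 * a * (fst \<xi> + m * snd \<xi>)"

definition dflat_map :: "real \<times> real \<Rightarrow> real \<times> real \<Rightarrow> real \<times> real" where
  "dflat_map q \<xi> = ((dnull1 q \<xi> + dnull2 \<xi>) / 2, s * (dnull1 q \<xi> - dnull2 \<xi>) / 2)"

lemma flat_map_null:
  assumes "q \<in> Aff"
  shows "flat_map A q = ((null1 q + null2 q) / 2, s * (null1 q - null2 q) / 2)"
proof -
  have y: "snd q > 0" using assms by (auto simp: Aff_def)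
  have "(snd q - 1) / (\<gamma> * snd q) = null1 q"
    using y \<gamma>_nz by (simp add: null1_def field_simps)
  moreover have "(fst q + m * (snd q - 1)) / f_coeff A / \<gamma> = - null2 q"
    unfolding divide_divide_eq_left f_\<gamma> using a_pos by (simp add: null2_def)
  ultimately show ?thesis by (simp add: flat_map_def Let_def)
qed

text \<open>
  The forms \<open>dnull1\<close> and \<open>dnull2\<close> are \<open>v\<^sub>1 + s v\<^sub>2\<close> and \<open>v\<^sub>1 - s v\<^sub>2\<close> rescaled by \<open>1/y\<close> and \<open>y\<close>. The
  factors cancel in the product, and being positive they do not affect the signs.
\<close>

lemma aff_null:
  assumes "q \<in> Aff"
  shows aff_form_null: "aff_form A q \<xi> = - (dnull1 q \<xi> * dnull2 \<xi>)"
    and aff_cone_null: "\<xi> \<in> aff_cone A q \<longleftrightarrow> 0 \<le> dnull1 q \<xi> \<and> 0 \<le> dnull2 \<xi>"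
proof -
  have y: "snd q > 0" using assms by (auto simp: Aff_def)
  define v where "v = A *v frame_coord q \<xi>"
  have v1: "v$1 = (a * fst \<xi> + A$1$2 * snd \<xi>) / snd q"
    by (simp add: v_def mv2 frame_coord_def add_divide_distrib)
  have v2: "v$2 = (- s * a * fst \<xi> + A$2$2 * snd \<xi>) / snd q"
    by (simp add: v_def mv2 frame_coord_def A21 add_divide_distrib diff_divide_distrib)
  have "v$1 + s * v$2 = (A$1$2 + s * A$2$2) * snd \<xi> / snd q"
    unfolding v1 v2 by (simp add: algebra_simps add_divide_distrib diff_divide_distrib)
  also have "A$1$2 + s * A$2$2 = 1 / \<gamma>"
    using A12_A22 \<gamma>_nz by (simp add: field_simps)
  finally have p: "v$1 + s * v$2 = snd q * dnull1 q \<xi>"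
    using y by (simp add: dnull1_def field_simps power2_eq_square)
  have "v$1 - s * v$2 = (2 * a * fst \<xi> + (A$1$2 - s * A$2$2) * snd \<xi>) / snd q"
    unfolding v1 v2 by (simp add: algebra_simps add_divide_distrib diff_divide_distrib)
  also have "A$1$2 - s * A$2$2 = 2 * a * m" by (simp add: m_eq)
  finally have r: "v$1 - s * v$2 = dnull2 \<xi> / snd q"
    by (simp add: dnull2_def algebra_simps)
  have "aff_form A q \<xi> = mink_form 0 (v$1, v$2)"
    by (simp add: aff_form_def v_def mink_form_def Let_def)
  also have "\<dots> = - (dnull1 q \<xi> * dnull2 \<xi>)"
    unfolding mink_form_null[OF s_abs] using p r y by simp
  finally show "aff_form A q \<xi> = - (dnull1 q \<xi> * dnull2 \<xi>)" .
  have "\<xi> \<in> aff_cone A q \<longleftrightarrow> (v$1, v$2) \<in> mink_cone 0"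
    by (simp add: aff_cone_def v_def mink_cone_def Let_def)
  also have "\<dots> \<longleftrightarrow> 0 \<le> dnull1 q \<xi> \<and> 0 \<le> dnull2 \<xi>"
    unfolding mink_cone_null[OF s_abs] using p r y
    by (simp add: zero_le_mult_iff zero_le_divide_iff)
  finally show "\<xi> \<in> aff_cone A q \<longleftrightarrow> 0 \<le> dnull1 q \<xi> \<and> 0 \<le> dnull2 \<xi>" .
qed

lemma dflat_map_null:
  "fst (dflat_map q \<xi>) + s * snd (dflat_map q \<xi>) = dnull1 q \<xi>"
  "fst (dflat_map q \<xi>) - s * snd (dflat_map q \<xi>) = dnull2 \<xi>"
  by (simp_all add: dflat_map_def algebra_simps flip: add_divide_distrib diff_divide_distrib)

lemma flat_map_in_half_plane:
  assumes "q \<in> Aff"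
  shows "flat_map A q \<in> half_plane A"
proof -
  have "s * snd (flat_map A q) + fst (flat_map A q) = null1 q"
    by (simp add: flat_map_null[OF assms] algebra_simps flip: add_divide_distrib diff_divide_distrib)
  moreover have "\<gamma> * null1 q < 1"
    using assms \<gamma>_nz by (auto simp: null1_def Aff_def)
  ultimately show ?thesis by (simp add: half_plane_def case_prod_unfold)
qed

lemma flat_map_deriv:
  assumes "q \<in> Aff"
  shows "(flat_map A has_derivative dflat_map q) (at q)"
proof -
  have y: "snd q > 0" using assms by (auto simp: Aff_def)
  have "open Aff"
    unfolding Aff_def case_prod_unfold by (intro open_Collect_less continuous_intros)
  have 1: "(null1 has_derivative dnull1 q) (at q)"
    unfolding null1_def [abs_def] dnull1_def [abs_def] using y \<gamma>_nz
    by (auto intro!: derivative_eq_intros simp: field_simps power2_eq_square)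
  have 2: "(null2 has_derivative dnull2) (at q)"
    unfolding null2_def [abs_def] dnull2_def [abs_def]
    by (auto intro!: derivative_eq_intros)
  have "((\<lambda>q. ((null1 q + null2 q) / 2, s * (null1 q - null2 q) / 2)) has_derivative dflat_map q) (at q)"
    unfolding dflat_map_def [abs_def]
    by (auto intro!: derivative_eq_intros 1 2)
  then show ?thesis
    by (rule has_derivative_transform_within_open[OF _ \<open>open Aff\<close> assms]) (simp add: flat_map_null)
qed

lemma flat_map_lipschitz:
  assumes "compact K" "K \<subseteq> Aff"
  shows "\<exists>L. L-lipschitz_on K (flat_map A)"
proof -
  have "\<And>q. q \<in> K \<Longrightarrow> snd q > 0" using assms by (auto simp: Aff_def)
  then obtain B3 where B3: "B3-lipschitz_on K (\<lambda>q. 1 / snd q)"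
    using Lipschitz_on_inverse_if_pos[OF \<open>compact K\<close> Lipschitz_on_snd] by blast
  have "\<exists>L. L-lipschitz_on K (\<lambda>q.
      ((1/2) * ((1/\<gamma>) * (1 - 1 / snd q) + (2 * a) * (fst q + m * (snd q - 1))),
       (s/2) * ((1/\<gamma>) * (1 - 1 / snd q) - (2 * a) * (fst q + m * (snd q - 1)))))"
    by (rule exI) (rule lipschitz_on_Pair lipschitz_on_cmult_real lipschitz_on_add lipschitz_on_diff
        lipschitz_on_constant Lipschitz_on_fst Lipschitz_on_snd B3)+
  then obtain L where L: "L-lipschitz_on K (\<lambda>q.
      ((1/2) * ((1/\<gamma>) * (1 - 1 / snd q) + (2 * a) * (fst q + m * (snd q - 1))),
       (s/2) * ((1/\<gamma>) * (1 - 1 / snd q) - (2 * a) * (fst q + m * (snd q - 1)))))" ..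
  have "L-lipschitz_on K (flat_map A)"
  proof (rule lipschitz_on_transform[OF L])
    fix q assume "q \<in> K"
    then have "q \<in> Aff" using assms by auto
    then show "flat_map A q =
      ((1/2) * ((1/\<gamma>) * (1 - 1 / snd q) + (2 * a) * (fst q + m * (snd q - 1))),
       (s/2) * ((1/\<gamma>) * (1 - 1 / snd q) - (2 * a) * (fst q + m * (snd q - 1))))"
      by (simp add: flat_map_null null1_def null2_def)
  qed
  then show ?thesis ..
qed

lemma aff_dist_le: "aff_dist A q1 q2 \<le> mink_dist (flat_map A q1) (flat_map A q2)"
  unfolding aff_dist_def mink_dist_def
proof (rule lorentz_dist_le_isometric_map[where DF = dflat_map])
  show "dflat_map q v \<in> mink_cone (flat_map A q)" if "q \<in> Aff" "v \<in> aff_cone A q" for q v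
    using that by (simp add: mink_cone_null[OF s_abs] dflat_map_null aff_cone_null)
  show "mink_form (flat_map A q) (dflat_map q v) = aff_form A q v" if "q \<in> Aff" for q v
    using that by (simp add: mink_form_null[OF s_abs] dflat_map_null aff_form_null)
qed (use flat_map_deriv flat_map_lipschitz in auto)

text \<open>
  The equation \<open>p = (1 - 1/y) / \<gamma>\<close> for the null coordinate \<open>p = x' + s y'\<close> is solved by
  \<open>y = 1 / (1 - \<gamma> p)\<close>, and the half-plane is the set where this is positive. In the differential
  below, \<open>\<eta>\<close> is the resulting value of \<open>dy\<close>.
\<close>

definition inv_flat_map :: "real \<times> real \<Rightarrow> real \<times> real" where
  "inv_flat_map z = (let y = 1 / (1 - \<gamma> * (fst z + s * snd z))
     in ((fst z - s * snd z) / (2 * a) - m * (y - 1), y))"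

definition dinv_flat_map :: "real \<times> real \<Rightarrow> real \<times> real \<Rightarrow> real \<times> real" where
  "dinv_flat_map z \<xi> =
    (let \<eta> = \<gamma> * (fst \<xi> + s * snd \<xi>) / (1 - \<gamma> * (fst z + s * snd z))\<^sup>2
     in ((fst \<xi> - s * snd \<xi>) / (2 * a) - m * \<eta>, \<eta>))"

lemma half_plane_iff: "z \<in> half_plane A \<longleftrightarrow> 1 - \<gamma> * (fst z + s * snd z) > 0"
  by (auto simp: half_plane_def case_prod_unfold algebra_simps)

lemma inv_flat_map_flat_map:
  assumes "q \<in> Aff"
  shows "inv_flat_map (flat_map A q) = q"
proof -
  have y: "snd q > 0" using assms by (auto simp: Aff_def)
  have 1: "fst (flat_map A q) + s * snd (flat_map A q) = null1 q"
    and 2: "fst (flat_map A q) - s * snd (flat_map A q) = null2 q"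
    by (simp_all add: flat_map_null[OF assms] algebra_simps flip: add_divide_distrib diff_divide_distrib)
  have "1 - \<gamma> * null1 q = 1 / snd q" using \<gamma>_nz by (simp add: null1_def)
  then show ?thesis
    unfolding inv_flat_map_def 1 2 using a_pos by (simp add: null2_def)
qed

lemma inv_flat_map_in_Aff: "z \<in> half_plane A \<Longrightarrow> inv_flat_map z \<in> Aff"
  by (simp add: half_plane_iff inv_flat_map_def Aff_def Let_def)

lemma dinv_flat_map_null:
  assumes "z \<in> half_plane A"
  shows "dnull1 (inv_flat_map z) (dinv_flat_map z \<xi>) = fst \<xi> + s * snd \<xi>"
    and "dnull2 (dinv_flat_map z \<xi>) = fst \<xi> - s * snd \<xi>"
  using assms \<gamma>_nz a_pos
  by (simp_all add: half_plane_iff dnull1_def dnull2_def inv_flat_map_def dinv_flat_map_def Let_def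
      power_divide)

lemma inv_flat_map_deriv:
  assumes "z \<in> half_plane A"
  shows "(inv_flat_map has_derivative dinv_flat_map z) (at z)"
proof -
  define k where "k = 1 - \<gamma> * (fst z + s * snd z)"
  have k: "k > 0" using assms by (simp add: half_plane_iff k_def)
  define Y where "Y = (\<lambda>z. 1 / (1 - \<gamma> * (fst z + s * snd z)))"
  have Y: "(Y has_derivative (\<lambda>\<xi>. \<gamma> * (fst \<xi> + s * snd \<xi>) / k\<^sup>2)) (at z)"
    using k unfolding k_def Y_def
    by (auto intro!: derivative_eq_intros simp: power2_eq_square)
  have "inv_flat_map = (\<lambda>z. ((fst z - s * snd z) / (2 * a) - m * (Y z - 1), Y z))"
    by (simp add: fun_eq_iff inv_flat_map_def Y_def Let_def)
  moreover have "((\<lambda>z. ((fst z - s * snd z) / (2 * a) - m * (Y z - 1), Y z))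
      has_derivative dinv_flat_map z) (at z)"
    unfolding dinv_flat_map_def [abs_def] Let_def k_def [symmetric]
    using a_pos by (auto intro!: derivative_eq_intros Y simp: fun_eq_iff field_simps)
  ultimately show ?thesis by simp
qed

lemma inv_flat_map_lipschitz:
  assumes "compact K" "K \<subseteq> half_plane A"
  shows "\<exists>L. L-lipschitz_on K inv_flat_map"
proof -
  have pos: "\<And>z. z \<in> K \<Longrightarrow> 1 - \<gamma> * (fst z + s * snd z) > 0" using assms half_plane_iff by blast
  have "\<exists>L. L-lipschitz_on K (\<lambda>z. 1 - \<gamma> * (fst z + s * snd z))"
    by (rule exI) (rule lipschitz_on_cmult_real lipschitz_on_add lipschitz_on_diff
        lipschitz_on_constant Lipschitz_on_fst Lipschitz_on_snd)+
  then obtain B3 where B3: "B3-lipschitz_on K (\<lambda>z. 1 / (1 - \<gamma> * (fst z + s * snd z)))"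
    using Lipschitz_on_inverse_if_pos[OF \<open>compact K\<close>,
        of _ "\<lambda>z. 1 - \<gamma> * (fst z + s * snd z)"] pos by blast
  have "\<exists>L. L-lipschitz_on K (\<lambda>z.
      ((1 / (2 * a)) * (fst z - s * snd z) - m * (1 / (1 - \<gamma> * (fst z + s * snd z)) - 1),
       1 / (1 - \<gamma> * (fst z + s * snd z))))"
    by (rule exI) (rule lipschitz_on_Pair lipschitz_on_cmult_real lipschitz_on_add lipschitz_on_diff
        lipschitz_on_constant Lipschitz_on_fst Lipschitz_on_snd B3)+
  then show ?thesis by (simp add: inv_flat_map_def [abs_def] Let_def)
qed

text \<open>
  The null coordinate at an intermediate time lies between its values at the ends. The later end
  gives the bound when \<open>\<gamma> > 0\<close>, the earlier end when \<open>\<gamma> < 0\<close>.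
\<close>

lemma half_plane_causally_convex:
  assumes q: "future_curve UNIV mink_cone q t0 t1"
    and ends: "q t0 \<in> half_plane A" "q t1 \<in> half_plane A"
  shows "q ` {t0..t1} \<subseteq> half_plane A"
proof (rule image_subsetI)
  fix t assume t: "t \<in> {t0..t1}"
  define p where "p = (\<lambda>t. fst (q t) + s * snd (q t))"
  have "p t0 \<le> p t" "p t \<le> p t1"
    unfolding p_def using t by (auto intro!: null_coordinate_mono[OF s_abs q])
  then have "\<gamma> * p t \<le> \<gamma> * p t0 \<or> \<gamma> * p t \<le> \<gamma> * p t1"
    by (cases "\<gamma> \<ge> 0") (auto intro: mult_left_mono mult_left_mono_neg)
  then show "q t \<in> half_plane A" using ends by (auto simp: half_plane_iff p_def)
qed

lemma mink_dist_le:
  assumes z: "z1 \<in> half_plane A" "z2 \<in> half_plane A"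
  shows "mink_dist z1 z2 \<le> aff_dist A (inv_flat_map z1) (inv_flat_map z2)"
proof -
  have "mink_dist z1 z2 = lorentz_dist (half_plane A) mink_form mink_cone z1 z2"
    unfolding mink_dist_def
    by (rule lorentz_dist_causally_convex [symmetric])
      (use half_plane_causally_convex z in auto)
  also have "\<dots> \<le> aff_dist A (inv_flat_map z1) (inv_flat_map z2)"
    unfolding aff_dist_def
  proof (rule lorentz_dist_le_isometric_map[where DF = dinv_flat_map])
    fix z v assume z: "z \<in> half_plane A"
    show "aff_form A (inv_flat_map z) (dinv_flat_map z v) = mink_form z v"
      using z by (simp add: mink_form_null[OF s_abs] aff_form_null inv_flat_map_in_Aff dinv_flat_map_null)
    show "dinv_flat_map z v \<in> aff_cone A (inv_flat_map z)" if "v \<in> mink_cone z"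
      using z that
      by (simp add: mink_cone_null[OF s_abs] aff_cone_null inv_flat_map_in_Aff dinv_flat_map_null)
  qed (use inv_flat_map_in_Aff inv_flat_map_deriv inv_flat_map_lipschitz in auto)
  finally show ?thesis .
qed

end

theorem theorem20:
  fixes A :: "real^2^2"
  assumes "det A > 0" and "A $ 1 $ 1 \<ge> 0" and "sectional_curvature A = 0"
  shows "flat_map A \<in> Aff \<rightarrow> half_plane A \<and>
    (\<forall>q1\<in>Aff. \<forall>q2\<in>Aff. mink_dist (flat_map A q1) (flat_map A q2) = aff_dist A q1 q2)"
proof -
  interpret flat_structure A using assms by unfold_locales
  have "mink_dist (flat_map A q1) (flat_map A q2) = aff_dist A q1 q2" if "q1 \<in> Aff" "q2 \<in> Aff" for q1 q2
    using aff_dist_le[of q1 q2] that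
      mink_dist_le[OF flat_map_in_half_plane flat_map_in_half_plane, of q1 q2]
    by (simp add: inv_flat_map_flat_map order_antisym)
  then show ?thesis using flat_map_in_half_plane by blast
qed

end
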